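(* Let $x=(x_1,x_2)\in\mathbb R_l^2$ with $\|x\|_l\ge1$. Then $$P_{\mathbb B_l}(x)=\Big\{y\in\mathbb B_l:\ \|y\|_l=1,\ \|x-y\|_l=\|x\|_l-1,\ \text{and for } n=1,2:\ 0\le y_n\le x_n\wedge1\text{ if }x_n\ge0,\ \ x_n\vee(-1)\le y_n\le0\text{ if }x_n<0\Big\}.$$ More precisely, $P_{\mathbb B_l}$ satisfies the following. (I) If $x_1\ge0$, $x_2\ge0$ and $x_1+x_2>1$, then $$P_{\mathbb B_l}(x)=\overline{(x_1\wedge1,\,1-(x_1\wedge1)),\ (1-(x_2\wedge1),\,x_2\wedge1)}.$$ In particular: (a) if $x_1\ge1$ and $x_2\ge1$, then $P_{\mathbb B_l}(x_1,x_2)=\overline{(1,0),(0,1)}$; (b) if $0\le x_1\le1$, $0\le x_2\le1$ and $x_1+x_2\ge1$, then $P_{\mathbb B_l}(x_1,x_2)=\overline{(x_1,1-x_1),(1-x_2,x_2)}$; (c) if $x_1\ge1$ and $0\le x_2\le1$, then $P_{\mathbb B_l}(x_1,x_2)=\overline{(1,0),(1-x_2,x_2)}$; (d) if $0\le x_1\le1$ and $x_2\ge1$, then $P_{\mathbb B_l}(x_1,x_2)=\overline{(x_1,1-x_1),(0,1)}$. (II) If $x_1\le0$, $x_2\ge0$ and $x_2-x_1\ge1$, then $$P_{\mathbb B_l}(x_1,x_2)=\overline{\big(x_1\vee(-1),\,1+(x_1\vee(-1))\big),\ \big((x_2\wedge1)-1,\,x_2\wedge1\big)}.$$ (III) If $x_1\le0$,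 $x_2\le0$ and $x_2+x_1\le-1$, then $$P_{\mathbb B_l}(x_1,x_2)=\overline{\big(x_1\vee(-1),\,-1-(x_1\vee(-1))\big),\ \big(-1-(x_2\vee(-1)),\,x_2\vee(-1)\big)}.$$ (IV) If $x_1\ge0$, $x_2\le0$ and $x_2-x_1\le-1$, then $$P_{\mathbb B_l}(x_1,x_2)=\overline{\big(x_1\wedge1,\,(x_1\wedge1)-1\big),\ \big(1+(x_2\vee(-1)),\,x_2\vee(-1)\big)}.$$ In particular: (i) $P_{\mathbb B_l}(x_1,0)=\{(1,0)\}$ for any $x_1\ge1$; (ii) $P_{\mathbb B_l}(0,x_2)=\{(0,1)\}$ for any $x_2\ge1$; (iii) $P_{\mathbb B_l}(x_1,0)=\{(-1,0)\}$ for any $x_1\le-1$; (iv) $P_{\mathbb B_l}(0,x_2)=\{(0,-1)\}$ for any $x_2\le-1$.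
   Context: $\mathbb R_l^2$ is $\mathbb R^2$ with the norm $\|(x_1,x_2)\|_l=|x_1|+|x_2|$, and $\mathbb B_l$ is its closed unit ball. The set-valued metric projection $P_{\mathbb B_l}:\mathbb R_l^2\rightrightarrows\mathbb B_l$ is $P_{\mathbb B_l}(x)=\{y\in\mathbb B_l:\|x-y\|_l=\min_{v\in\mathbb B_l}\|x-v\|_l\}$. For real $a,b$: $a\wedge b=\min\{a,b\}$, $a\vee b=\max\{a,b\}$. For points $p,q\in\mathbb R^2$, $\overline{p,q}$ denotes the closed line segment with endpoints $p$ and $q$ (with $\overline{p,p}=\{p\}$). *)

theory Defs
  imports "HOL-Analysis.Analysis"
begin

text \<open>
  The library norm on \<^typ>\<open>real^2\<close> is Euclidean, so the \<open>l\<^sub>1\<close> norm is introduced as a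
  separate function on the same vector space.
\<close>

definition l1norm :: "real^2 \<Rightarrow> real" where
  "l1norm x = \<bar>x $ 1\<bar> + \<bar>x $ 2\<bar>"

definition l1ball :: "(real^2) set" where
  "l1ball = {y. l1norm y \<le> 1}"

text \<open>
  The set-valued metric projection onto \<open>C\<close>: all points of \<open>C\<close> at which \<open>v \<mapsto> l1norm (x - v)\<close>
  attains its minimum over \<open>C\<close>.
\<close>

definition l1proj :: "(real^2) set \<Rightarrow> real^2 \<Rightarrow> (real^2) set" where
  "l1proj C x = {y. is_arg_min (\<lambda>v. l1norm (x - v)) (\<lambda>v. v \<in> C) y}"

abbreviation pt :: "real \<Rightarrow> real \<Rightarrow> real^2" where
  "pt a b \<equiv> vector [a, b]"

end

theory Submission
  imports Defs
begin

text \<open>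
  For \<open>\<parallel>x\<parallel> \<ge> 1\<close> the distance from \<open>x\<close> to the ball is \<open>\<parallel>x\<parallel> - 1\<close>, by the triangle inequality and
  the radial point \<open>x / \<parallel>x\<parallel>\<close>. Hence \<open>y\<close> is a projection iff \<open>\<parallel>y\<parallel> = 1\<close> and
  \<open>\<parallel>x - y\<parallel> + \<parallel>y\<parallel> = \<parallel>x\<parallel>\<close>. Equality in the triangle inequality of the \<open>l\<^sub>1\<close> norm means equality in each
  coordinate, i.e. every \<open>y\<^sub>n\<close> lies between \<open>0\<close> and \<open>x\<^sub>n\<close>. In a fixed quadrant, the points
  satisfying these conditions fill a segment of one side of the unit sphere.
\<close>

lemma l1norm_pt [simp]: "l1norm (pt a b) = \<bar>a\<bar> + \<bar>b\<bar>"
  by (simp add: l1norm_def)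

lemma mem_l1ball: "y \<in> l1ball \<longleftrightarrow> l1norm y \<le> 1"
  by (simp add: l1ball_def)

lemma l1norm_triangle: "l1norm x \<le> l1norm (x - y) + l1norm y"
  by (simp add: l1norm_def)

lemma l1norm_scaleR: "l1norm (c *\<^sub>R x) = \<bar>c\<bar> * l1norm x"
  by (simp add: l1norm_def abs_mult distrib_left)

lemma mem_l1proj_l1ball_iff:
  assumes "l1norm x \<ge> 1"
  shows "y \<in> l1proj l1ball x \<longleftrightarrow> l1norm y = 1 \<and> l1norm (x - y) = l1norm x - 1"
proof
  define v where "v = (1 / l1norm x) *\<^sub>R x"
  have v: "l1norm v = 1"
    using assms by (simp add: v_def l1norm_scaleR)
  have "x - v = (1 - 1 / l1norm x) *\<^sub>R x"
    by (simp add: v_def scaleR_left_diff_distrib)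
  then have xv: "l1norm (x - v) = l1norm x - 1"
    using assms by (simp only: l1norm_scaleR) (simp add: left_diff_distrib)
  assume "y \<in> l1proj l1ball x"
  then have "l1norm y \<le> 1" "\<not> l1norm (x - v) < l1norm (x - y)"
    using v by (auto simp: l1proj_def is_arg_min_def mem_l1ball)
  \<comment> \<open>Minimality against \<open>v\<close> gives
    \<open>l1norm (x - y) \<le> l1norm x - 1\<close>; together with \<open>l1norm y \<le> 1\<close>
    this makes the triangle inequality tight and forces both equalities.\<close>
  with xv l1norm_triangle[of x y] show "l1norm y = 1 \<and> l1norm (x - y) = l1norm x - 1"
    by linarith
next
  assume y: "l1norm y = 1 \<and> l1norm (x - y) = l1norm x - 1"
  have "\<not> l1norm (x - z) < l1norm (x - y)" if "l1norm z \<le> 1" for z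
    using that y l1norm_triangle[of x z] by linarith
  with y show "y \<in> l1proj l1ball x"
    by (auto simp: l1proj_def is_arg_min_def mem_l1ball)
qed

text \<open>Each \<open>\<bar>x $ n - y $ n\<bar> - \<bar>x $ n\<bar> + \<bar>y $ n\<bar>\<close> is
  nonnegative, so their sum vanishes only if both do.\<close>

lemma l1norm_diff_eq_iff:
  "l1norm (x - y) = l1norm x - l1norm y \<longleftrightarrow>
    (\<forall>n. (x $ n \<ge> 0 \<longrightarrow> 0 \<le> y $ n \<and> y $ n \<le> x $ n) \<and>
         (x $ n < 0 \<longrightarrow> x $ n \<le> y $ n \<and> y $ n \<le> 0))"
  unfolding l1norm_def forall_2 vector_minus_component by argo

lemma mem_l1proj_l1ball_iff_between:
  assumes "l1norm x \<ge> 1"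
  shows "y \<in> l1proj l1ball x \<longleftrightarrow> l1norm y = 1 \<and>
    (\<forall>n. (x $ n \<ge> 0 \<longrightarrow> 0 \<le> y $ n \<and> y $ n \<le> x $ n) \<and>
         (x $ n < 0 \<longrightarrow> x $ n \<le> y $ n \<and> y $ n \<le> 0))"
  using mem_l1proj_l1ball_iff[OF assms, of y] l1norm_diff_eq_iff[of x y] by auto

lemma abs_component_le_l1norm: "\<bar>y $ n\<bar> \<le> l1norm y"
  using exhaust_2[of n] by (auto simp: l1norm_def)

text \<open>The truncations at \<open>1\<close> and \<open>-1\<close> come from
  \<open>\<bar>y $ n\<bar> \<le> l1norm y = 1\<close>, the bounds by \<open>x $ n\<close> from the
  equality case of the triangle inequality.\<close>

lemma l1proj_l1ball_eq:
  assumes "l1norm x \<ge> 1"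
  shows "l1proj l1ball x =
    {y \<in> l1ball. l1norm y = 1 \<and> l1norm (x - y) = l1norm x - 1 \<and>
       (\<forall>n. (x $ n \<ge> 0 \<longrightarrow> 0 \<le> y $ n \<and> y $ n \<le> min (x $ n) 1) \<and>
            (x $ n < 0 \<longrightarrow> max (x $ n) (-1) \<le> y $ n \<and> y $ n \<le> 0))}"
proof -
  have bd: "y $ n \<le> 1" "-1 \<le> y $ n" if "l1norm y = 1" for y n
    using abs_component_le_l1norm[of y n] that by linarith+
  have "(x $ n \<ge> 0 \<longrightarrow> 0 \<le> y $ n \<and> y $ n \<le> x $ n) \<and>
      (x $ n < 0 \<longrightarrow> x $ n \<le> y $ n \<and> y $ n \<le> 0)"
    if "l1norm y = 1" "l1norm (x - y) = l1norm x - 1" for y n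
    using that l1norm_diff_eq_iff[of x y] by simp
  with bd show ?thesis
    by (auto simp: mem_l1proj_l1ball_iff[OF assms] mem_l1ball)
qed

text \<open>On the line \<open>s * y $ 1 + t * y $ 2 = 1\<close>, the value
  \<open>r = s * y $ 1\<close> is an affine parameter, which turns the segment into a real
  interval.\<close>

lemma mem_closed_segment_pt_iff:
  fixes s t c d :: real
  assumes "\<bar>s\<bar> = 1" "\<bar>t\<bar> = 1" "c \<le> d"
  shows "y \<in> closed_segment (pt (s * d) (t * (1 - d))) (pt (s * c) (t * (1 - c))) \<longleftrightarrow>
    s * y $ 1 + t * y $ 2 = 1 \<and> c \<le> s * y $ 1 \<and> s * y $ 1 \<le> d"
proof -
  have ss: "s * (s * r) = r" "t * (t * r) = r" for r
    using assms(1,2) by (auto simp: abs_if split: if_splits)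
  \<comment> \<open>Multiplication by a sign is an involution.\<close>
  have eq1: "y $ 1 = s * r \<longleftrightarrow> s * y $ 1 = r" and eq2: "y $ 2 = t * r \<longleftrightarrow> t * y $ 2 = r" for r
    using ss by metis+
  have "y \<in> closed_segment (pt (s * d) (t * (1 - d))) (pt (s * c) (t * (1 - c))) \<longleftrightarrow>
      (\<exists>u. 0 \<le> u \<and> u \<le> 1 \<and> y $ 1 = s * ((1 - u) * d + u * c) \<and>
        y $ 2 = t * (1 - ((1 - u) * d + u * c)))"
    by (simp add: in_segment vec_eq_iff forall_2 algebra_simps)
  also have "\<dots> \<longleftrightarrow> (\<exists>r. r \<in> closed_segment d c \<and> s * y $ 1 = r \<and> t * y $ 2 = 1 - r)"
    unfolding eq1 eq2 by (auto simp: in_segment)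
  also have "\<dots> \<longleftrightarrow> s * y $ 1 + t * y $ 2 = 1 \<and> c \<le> s * y $ 1 \<and> s * y $ 1 \<le> d"
    using assms(3) by (auto simp: closed_segment_eq_real_ivl)
  finally show ?thesis .
qed

text \<open>
  The signs \<open>s\<close> and \<open>t\<close> select the quadrant, so that \<open>p\<close> and \<open>q\<close> are the absolute values of the
  coordinates.
\<close>

lemma l1proj_l1ball_quadrant:
  fixes s t p q :: real
  assumes s: "\<bar>s\<bar> = 1" and t: "\<bar>t\<bar> = 1" and p: "p \<ge> 0" and q: "q \<ge> 0" and pq: "p + q \<ge> 1"
  shows "l1proj l1ball (pt (s * p) (t * q)) =
    closed_segment (pt (s * min p 1) (t * (1 - min p 1))) (pt (s * (1 - min q 1)) (t * min q 1))"
proof (rule set_eqI)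
  fix y
  have "l1norm (pt (s * p) (t * q)) \<ge> 1"
    using assms by (simp add: abs_mult)
  \<comment> \<open>Betweenness says \<open>0 \<le> s * y $ 1 \<le> p\<close> and
    \<open>0 \<le> t * y $ 2 \<le> q\<close>. Substituting \<open>t * y $ 2 = 1 - s * y $ 1\<close>
    turns the second pair into bounds on \<open>s * y $ 1\<close>.\<close>
  then have "y \<in> l1proj l1ball (pt (s * p) (t * q)) \<longleftrightarrow>
      s * y $ 1 + t * y $ 2 = 1 \<and> 1 - min q 1 \<le> s * y $ 1 \<and> s * y $ 1 \<le> min p 1"
    unfolding mem_l1proj_l1ball_iff_between[OF \<open>l1norm _ \<ge> 1\<close>] forall_2 vector_2 l1norm_def
    using assms by (auto simp: abs_if min_def split: if_splits)
  also have "\<dots> \<longleftrightarrow> y \<in> closed_segment (pt (s * min p 1) (t * (1 - min p 1)))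
      (pt (s * (1 - min q 1)) (t * min q 1))"
    \<comment> \<open>The interval is nonempty: \<open>min p 1 + min q 1 \<ge> 1\<close> follows
      from \<open>p + q \<ge> 1\<close> and nonnegativity.\<close>
    using mem_closed_segment_pt_iff[OF s t, of "1 - min q 1" "min p 1" y] p q pq by auto
  finally show "y \<in> l1proj l1ball (pt (s * p) (t * q)) \<longleftrightarrow> y \<in> closed_segment
      (pt (s * min p 1) (t * (1 - min p 1))) (pt (s * (1 - min q 1)) (t * min q 1))" .
qed

lemma
  fixes x1 x2 :: real
  shows l1proj_l1ball_quadrant1: "x1 \<ge> 0 \<Longrightarrow> x2 \<ge> 0 \<Longrightarrow> x1 + x2 \<ge> 1 \<Longrightarrow>
      l1proj l1ball (pt x1 x2) =
        closed_segment (pt (min x1 1) (1 - min x1 1)) (pt (1 - min x2 1) (min x2 1))"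
    and l1proj_l1ball_quadrant2: "x1 \<le> 0 \<Longrightarrow> x2 \<ge> 0 \<Longrightarrow> x2 - x1 \<ge> 1 \<Longrightarrow>
      l1proj l1ball (pt x1 x2) =
        closed_segment (pt (max x1 (-1)) (1 + max x1 (-1))) (pt (min x2 1 - 1) (min x2 1))"
    and l1proj_l1ball_quadrant3: "x1 \<le> 0 \<Longrightarrow> x2 \<le> 0 \<Longrightarrow> x2 + x1 \<le> -1 \<Longrightarrow>
      l1proj l1ball (pt x1 x2) =
        closed_segment (pt (max x1 (-1)) (-1 - max x1 (-1))) (pt (-1 - max x2 (-1)) (max x2 (-1)))"
    and l1proj_l1ball_quadrant4: "x1 \<ge> 0 \<Longrightarrow> x2 \<le> 0 \<Longrightarrow> x2 - x1 \<le> -1 \<Longrightarrow>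
      l1proj l1ball (pt x1 x2) =
        closed_segment (pt (min x1 1) (min x1 1 - 1)) (pt (1 + max x2 (-1)) (max x2 (-1)))"
proof -
  \<comment> \<open>Turns the truncated absolute value of a nonpositive coordinate into the
    \<open>max\<close> form.\<close>
  have m: "min (- r) 1 = - max r (-1)" for r :: real
    by (simp add: min_def max_def)
  show "x1 \<ge> 0 \<Longrightarrow> x2 \<ge> 0 \<Longrightarrow> x1 + x2 \<ge> 1 \<Longrightarrow> l1proj l1ball (pt x1 x2) =
      closed_segment (pt (min x1 1) (1 - min x1 1)) (pt (1 - min x2 1) (min x2 1))"
    using l1proj_l1ball_quadrant[of 1 1 x1 x2] by simp
  show "x1 \<le> 0 \<Longrightarrow> x2 \<ge> 0 \<Longrightarrow> x2 - x1 \<ge> 1 \<Longrightarrow> l1proj l1ball (pt x1 x2) =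
      closed_segment (pt (max x1 (-1)) (1 + max x1 (-1))) (pt (min x2 1 - 1) (min x2 1))"
    using l1proj_l1ball_quadrant[of "-1" 1 "-x1" x2] by (simp add: m)
  show "x1 \<le> 0 \<Longrightarrow> x2 \<le> 0 \<Longrightarrow> x2 + x1 \<le> -1 \<Longrightarrow> l1proj l1ball (pt x1 x2) =
      closed_segment (pt (max x1 (-1)) (-1 - max x1 (-1))) (pt (-1 - max x2 (-1)) (max x2 (-1)))"
    using l1proj_l1ball_quadrant[of "-1" "-1" "-x1" "-x2"] by (simp add: m algebra_simps)
  show "x1 \<ge> 0 \<Longrightarrow> x2 \<le> 0 \<Longrightarrow> x2 - x1 \<le> -1 \<Longrightarrow> l1proj l1ball (pt x1 x2) =
      closed_segment (pt (min x1 1) (min x1 1 - 1)) (pt (1 + max x2 (-1)) (max x2 (-1)))"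
    using l1proj_l1ball_quadrant[of 1 "-1" x1 "-x2"] by (simp add: m)
qed

theorem proposition4p1:
  shows
    "(\<forall>x. l1norm x \<ge> 1 \<longrightarrow>
        l1proj l1ball x =
          {y \<in> l1ball. l1norm y = 1 \<and> l1norm (x - y) = l1norm x - 1 \<and>
             (\<forall>n. (x $ n \<ge> 0 \<longrightarrow> 0 \<le> y $ n \<and> y $ n \<le> min (x $ n) 1) \<and>
                  (x $ n < 0 \<longrightarrow> max (x $ n) (-1) \<le> y $ n \<and> y $ n \<le> 0))}) \<and>
     \<comment> \<open>(I)\<close>
     (\<forall>x1 x2. x1 \<ge> 0 \<and> x2 \<ge> 0 \<and> x1 + x2 > 1 \<longrightarrow>
        l1proj l1ball (pt x1 x2) =
          closed_segment (pt (min x1 1) (1 - min x1 1)) (pt (1 - min x2 1) (min x2 1))) \<and>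
     \<comment> \<open>(a)\<close>
     (\<forall>x1 x2. x1 \<ge> 1 \<and> x2 \<ge> 1 \<longrightarrow>
        l1proj l1ball (pt x1 x2) = closed_segment (pt 1 0) (pt 0 1)) \<and>
     \<comment> \<open>(b)\<close>
     (\<forall>x1 x2. 0 \<le> x1 \<and> x1 \<le> 1 \<and> 0 \<le> x2 \<and> x2 \<le> 1 \<and> x1 + x2 \<ge> 1 \<longrightarrow>
        l1proj l1ball (pt x1 x2) = closed_segment (pt x1 (1 - x1)) (pt (1 - x2) x2)) \<and>
     \<comment> \<open>(c)\<close>
     (\<forall>x1 x2. x1 \<ge> 1 \<and> 0 \<le> x2 \<and> x2 \<le> 1 \<longrightarrow>
        l1proj l1ball (pt x1 x2) = closed_segment (pt 1 0) (pt (1 - x2) x2)) \<and>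
     \<comment> \<open>(d)\<close>
     (\<forall>x1 x2. 0 \<le> x1 \<and> x1 \<le> 1 \<and> x2 \<ge> 1 \<longrightarrow>
        l1proj l1ball (pt x1 x2) = closed_segment (pt x1 (1 - x1)) (pt 0 1)) \<and>
     \<comment> \<open>(II)\<close>
     (\<forall>x1 x2. x1 \<le> 0 \<and> x2 \<ge> 0 \<and> x2 - x1 \<ge> 1 \<longrightarrow>
        l1proj l1ball (pt x1 x2) =
          closed_segment (pt (max x1 (-1)) (1 + max x1 (-1))) (pt (min x2 1 - 1) (min x2 1))) \<and>
     \<comment> \<open>(III)\<close>
     (\<forall>x1 x2. x1 \<le> 0 \<and> x2 \<le> 0 \<and> x2 + x1 \<le> -1 \<longrightarrow>
        l1proj l1ball (pt x1 x2) =
          closed_segment (pt (max x1 (-1)) (-1 - max x1 (-1))) (pt (-1 - max x2 (-1)) (max x2 (-1)))) \<and>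
     \<comment> \<open>(IV)\<close>
     (\<forall>x1 x2. x1 \<ge> 0 \<and> x2 \<le> 0 \<and> x2 - x1 \<le> -1 \<longrightarrow>
        l1proj l1ball (pt x1 x2) =
          closed_segment (pt (min x1 1) (min x1 1 - 1)) (pt (1 + max x2 (-1)) (max x2 (-1)))) \<and>
     \<comment> \<open>(i)--(iv)\<close>
     (\<forall>x1. x1 \<ge> 1 \<longrightarrow> l1proj l1ball (pt x1 0) = {pt 1 0}) \<and>
     (\<forall>x2. x2 \<ge> 1 \<longrightarrow> l1proj l1ball (pt 0 x2) = {pt 0 1}) \<and>
     (\<forall>x1. x1 \<le> -1 \<longrightarrow> l1proj l1ball (pt x1 0) = {pt (-1) 0}) \<and>
     (\<forall>x2. x2 \<le> -1 \<longrightarrow> l1proj l1ball (pt 0 x2) = {pt 0 (-1)})"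
  \<comment> \<open>In (a)-(d) the truncations evaluate; in (i)-(iv) the two endpoints
    coincide.\<close>
  by (intro conjI allI impI; (elim conjE)?;
      (erule l1proj_l1ball_eq | simp add: l1proj_l1ball_quadrant1 l1proj_l1ball_quadrant2
        l1proj_l1ball_quadrant3 l1proj_l1ball_quadrant4))

end
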